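(* Let $$T_{Leit,5}=a_1\otimes(b_1\otimes c_1+b_2\otimes c_2+b_3\otimes c_3+b_4\otimes c_4+b_5\otimes c_5)+a_2\otimes(b_1\otimes c_3+b_3\otimes c_5)+a_3\otimes b_1\otimes c_4+a_4\otimes b_2\otimes c_4+a_5\otimes b_2\otimes c_5\in A\otimes B\otimes C=(\mathbb{C}^5)^{\otimes 3},$$ which gives rise to the linear space $$T_{Leit,5}(A^* )=\begin{pmatrix}x_1&&&&\\ 0&x_1&&&\\ x_2&0&x_1&&\\ x_3&x_4&0&x_1&\\ 0&x_5&x_2&0&x_1\end{pmatrix}.$$ Let $\alpha^1\in A^*$ be the element dual to $a_1$ in the dual basis. Then $\mathcal{E}_{\alpha^1}(T_{Leit,5})$ is an abelian Lie algebra, but not closed under composition; i.e., $T_{Leit,5}\in Abel_A$ but $T_{Leit,5}\notin End\text{-}Abel_A$. In particular, $T_{Leit,5}\notin Diag_A$, so $\underline{\mathbf R}(T_{Leit,5})>5$. In fact, $\underline{\mathbf R}(T_{Leit,5})=6$ and $\mathbf R(T_{Leit,5})=9$.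
   Context: All vector spaces are over $\mathbb{C}$; $\{a_i\},\{b_i\},\{c_i\}$ are bases of $A,B,C$, each of dimension $m$ (here $m=5$). $T$ is viewed as a linear map $T:A^*\to B\otimes C\simeq\mathrm{Hom}(C^*,B)$; in the matrix $T(A^* )$ blank entries are zero and $x_i\in\mathbb{C}$ are coordinates on $A^*$. $T$ is $A$-concise if this map is injective, and $1_A$-generic if some $T(\alpha)$ has rank $m$. For $\alpha_0\in A^*$ with $T(\alpha_0)$ invertible, $\mathcal{E}_{\alpha_0}(T)=\{T(\alpha)T(\alpha_0)^{-1}\mid\alpha\in A^*\}\subset\mathrm{End}(B)$. $Abel_A$ is the set of (classes of) $A$-concise tensors $T$ for which there is $\alpha_0$ with $T(\alpha_0)$ of rank $m$ and $\mathcal{E}_{\alpha_0}(T)$ an abelian Lie subalgebra of $\mathfrak{gl}(B)$ (i.e. consisting of commuting endomorphisms). $End\text{-}Abel_A$ is the set of $T\in Abel_A$ for which there is $\alpha$ with $T(\alpha)$ of rank $m$ and $\mathcal{E}_\alpha(T)$ closed under composition. $Diag_A$ is the Zariski closure of the set of $A$-concise tensors $T$ for which there is $\alpha_0$ with $T(\alpha_0)$ of rank $m$ and $\mathcal{E}_{\alpha_0}(T)$ simultaneously diagonalizable. $\mathbf R(T)$ is the tensor rank (least number of tensors $a\otimes b\otimes c$ summing to $T$) and $\underline{\mathbf R}(T)$ the border rank (least $r$ such that $T$ is a limit of tensors of rank $r$). *)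

theory Defs
  imports "HOL-Analysis.Analysis"
begin

text \<open>
  Tensors in \<open>A \<otimes> B \<otimes> C\<close> are given by their coordinates in the fixed bases \<open>a\<^sub>i\<close>, \<open>b\<^sub>j\<close>, \<open>c\<^sub>k\<close>:
  \<open>T $ i $ j $ k\<close> is the coefficient of \<open>a\<^sub>i \<otimes> b\<^sub>j \<otimes> c\<^sub>k\<close>. An element of the dual space of \<open>A\<close> is given
  by its coordinates in the dual basis.
\<close>

type_synonym ('a, 'b, 'c) tensor = "complex^'c^'b^'a"

definition tensor3 ::
  "complex^'a::finite \<Rightarrow> complex^'b::finite \<Rightarrow> complex^'c::finite \<Rightarrow> ('a, 'b, 'c) tensor" where
  "tensor3 a b c = (\<chi> i j k. a $ i * b $ j * c $ k)"

text \<open>Rows of \<open>contract T \<alpha>\<close> are indexed by \<open>B\<close> and columns by \<open>C\<close>, as for \<open>Hom(C\<^sup>*, B)\<close>.\<close>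

definition contract ::
  "('a::finite, 'b::finite, 'c::finite) tensor \<Rightarrow> complex^'a \<Rightarrow> complex^'c^'b" where
  "contract T \<alpha> = (\<chi> j k. \<Sum>i\<in>UNIV. \<alpha> $ i * T $ i $ j $ k)"

definition A_concise :: "('a::finite, 'b::finite, 'c::finite) tensor \<Rightarrow> bool" where
  "A_concise T \<longleftrightarrow> inj (contract T)"

definition Espace :: "('m::finite, 'm, 'm) tensor \<Rightarrow> complex^'m \<Rightarrow> (complex^'m^'m) set" where
  "Espace T \<alpha>\<^sub>0 = {contract T \<alpha> ** matrix_inv (contract T \<alpha>\<^sub>0) |\<alpha>. True}"

definition lie_bracket :: "complex^'m::finite^'m \<Rightarrow> complex^'m^'m \<Rightarrow> complex^'m^'m" where
  "lie_bracket X Y = X ** Y - Y ** X"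

definition lie_subalgebra :: "(complex^'m::finite^'m) set \<Rightarrow> bool" where
  "lie_subalgebra S \<longleftrightarrow> module.subspace (\<lambda>c. map_matrix ((*) c)) S \<and>
     (\<forall>X\<in>S. \<forall>Y\<in>S. lie_bracket X Y \<in> S)"

definition abelian_lie_subalgebra :: "(complex^'m::finite^'m) set \<Rightarrow> bool" where
  "abelian_lie_subalgebra S \<longleftrightarrow> lie_subalgebra S \<and> (\<forall>X\<in>S. \<forall>Y\<in>S. lie_bracket X Y = 0)"

definition closed_under_composition :: "(complex^'m::finite^'m) set \<Rightarrow> bool" where
  "closed_under_composition S \<longleftrightarrow> (\<forall>X\<in>S. \<forall>Y\<in>S. X ** Y \<in> S)"

definition simultaneously_diagonalizable :: "(complex^'m::finite^'m) set \<Rightarrow> bool" where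
  "simultaneously_diagonalizable S \<longleftrightarrow>
     (\<exists>P :: complex^'m^'m. invertible P \<and>
        (\<forall>X\<in>S. \<forall>i j. i \<noteq> j \<longrightarrow> (matrix_inv P ** X ** P) $ i $ j = 0))"

definition Abel_A :: "('m::finite, 'm, 'm) tensor set" where
  "Abel_A = {T. A_concise T \<and>
     (\<exists>\<alpha>\<^sub>0. rank (contract T \<alpha>\<^sub>0) = CARD('m) \<and> abelian_lie_subalgebra (Espace T \<alpha>\<^sub>0))}"

definition End_Abel_A :: "('m::finite, 'm, 'm) tensor set" where
  "End_Abel_A = {T \<in> Abel_A.
     \<exists>\<alpha>. rank (contract T \<alpha>) = CARD('m) \<and> closed_under_composition (Espace T \<alpha>)}"

inductive_set tensor_polynomials ::
  "(('a::finite, 'b::finite, 'c::finite) tensor \<Rightarrow> complex) set" where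
  const: "(\<lambda>T. z) \<in> tensor_polynomials"
| coord: "(\<lambda>T. T $ i $ j $ k) \<in> tensor_polynomials"
| add: "p \<in> tensor_polynomials \<Longrightarrow> q \<in> tensor_polynomials
    \<Longrightarrow> (\<lambda>T. p T + q T) \<in> tensor_polynomials"
| mult: "p \<in> tensor_polynomials \<Longrightarrow> q \<in> tensor_polynomials
    \<Longrightarrow> (\<lambda>T. p T * q T) \<in> tensor_polynomials"

definition zariski_closure ::
  "('a::finite, 'b::finite, 'c::finite) tensor set \<Rightarrow> ('a, 'b, 'c) tensor set" where
  "zariski_closure S =
     {T. \<forall>p\<in>tensor_polynomials. (\<forall>X\<in>S. p X = 0) \<longrightarrow> p T = 0}"

text \<open>
  The closure is taken in affine space. The set being closed is stable under nonzero scalars, so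
  the nonzero points of the closure are exactly the tensors whose classes lie in the Zariski
  closure in projective space.
\<close>

definition Diag_A :: "('m::finite, 'm, 'm) tensor set" where
  "Diag_A = zariski_closure {T. A_concise T \<and>
     (\<exists>\<alpha>\<^sub>0. rank (contract T \<alpha>\<^sub>0) = CARD('m) \<and>
        simultaneously_diagonalizable (Espace T \<alpha>\<^sub>0))}"

definition tensor_rank :: "('a::finite, 'b::finite, 'c::finite) tensor \<Rightarrow> nat" where
  "tensor_rank T = (LEAST r. \<exists>a b c. T = (\<Sum>l<r. tensor3 (a l) (b l) (c l)))"

definition border_rank :: "('a::finite, 'b::finite, 'c::finite) tensor \<Rightarrow> nat" where
  "border_rank T = (LEAST r. \<exists>X. (\<forall>n::nat. tensor_rank (X n) = r) \<and> X \<longlonglongrightarrow> T)"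

abbreviation basis_vec :: "'m::finite \<Rightarrow> complex^'m" where
  "basis_vec i \<equiv> axis i 1"

text \<open>The index type \<open>5\<close> has the elements 1, 2, 3, 4 and 5, where 5 coincides with 0.\<close>

definition T_Leit5 :: "(5, 5, 5) tensor" where
  "T_Leit5 = (let e = (\<lambda>i j k. tensor3 (basis_vec i) (basis_vec j) (basis_vec k)) in
     e 1 1 1 + e 1 2 2 + e 1 3 3 + e 1 4 4 + e 1 5 5
     + e 2 1 3 + e 2 3 5
     + e 3 1 4
     + e 4 2 4
     + e 5 2 5)"

end

theory Submission
  imports Defs
begin

text \<open>
  Write \<open>X(\<alpha>)\<close> for \<open>contract X \<alpha>\<close> and \<open>\<alpha>\<^sup>i\<close> for the dual basis. A 5 x 5 x 5 tensor \<open>X\<close> of rank at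
  most 5 is \<open>X(\<alpha>) = B D(\<alpha>) C\<close> with \<open>D(\<alpha>)\<close> diagonal; so if \<open>X(\<alpha>\<^sup>1)\<close> is invertible and \<open>X\<close> is concise,
  the matrix \<open>X(\<alpha>\<^sup>2) X(\<alpha>\<^sup>1)\<inverse> X(\<alpha>\<^sup>2)\<close> is again of the form \<open>X(\<alpha>)\<close>. Replacing the inverse by the
  adjugate, this is the vanishing of 6 x 6 minors, polynomials in the entries of \<open>X\<close>. One of
  them, which also vanishes on \<open>Diag_A\<close>, does not vanish at \<open>T_Leit5\<close>, because the square of its
  second slice leaves the space; this gives border rank at least 6. Six moving rank one tensors
  converging to \<open>T_Leit5\<close> give equality. For the rank, killing four terms of a decomposition leaves
  a sum that still has to be an invertible 5 x 5 matrix, so there are at least 4 + 5 terms.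
\<close>

section \<open>The index type \<open>5\<close>\<close>

lemma exhaust_5:
  fixes x :: 5
  shows "x = 1 \<or> x = 2 \<or> x = 3 \<or> x = 4 \<or> x = 5"
proof (induct x)
  case (of_int z)
  then have "z = 0 \<or> z = 1 \<or> z = 2 \<or> z = 3 \<or> z = 4" by fastforce
  then show ?case by auto
qed

lemma forall_5: "(\<forall>i::5. P i) \<longleftrightarrow> P 1 \<and> P 2 \<and> P 3 \<and> P 4 \<and> P 5"
  by (metis exhaust_5)

lemma UNIV_5: "UNIV = {1, 2, 3, 4, 5::5}"
  using exhaust_5 by auto

lemma sum_5: "sum f (UNIV::5 set) = f 1 + f 2 + f 3 + f 4 + f 5"
  unfolding UNIV_5 by (simp add: ac_simps)

lemma vector_5:
  fixes x y z u v :: "'a::zero"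
  shows "(vector [x,y,z,u,v] :: 'a^5) $ 1 = x"
    "(vector [x,y,z,u,v] :: 'a^5) $ 2 = y"
    "(vector [x,y,z,u,v] :: 'a^5) $ 3 = z"
    "(vector [x,y,z,u,v] :: 'a^5) $ 4 = u"
    "(vector [x,y,z,u,v] :: 'a^5) $ 5 = v"
  unfolding vector_def by simp_all

subsection \<open>Tensor rank\<close>

lemma tensor_decomposition_list:
  "(\<Sum>(a, b, c)\<leftarrow>L. tensor3 a b c) =
     (\<Sum>l<length L. tensor3 (fst (L ! l)) (fst (snd (L ! l))) (snd (snd (L ! l))))"
  by (simp add: sum_list_sum_nth atLeast0LessThan case_prod_unfold)

lemma tensor_rank_le:
  assumes "T = (\<Sum>(a, b, c)\<leftarrow>L. tensor3 a b c)"
  shows "tensor_rank T \<le> length L"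
  unfolding tensor_rank_def assms tensor_decomposition_list
  by (intro Least_le exI) (rule refl)

text \<open>The \<open>LEAST\<close> in \<open>tensor_rank\<close> is meaningful because the
  expansion in coordinates is already a finite decomposition.\<close>

lemma tensor_rank_attained:
  fixes T :: "('a::finite, 'b::finite, 'c::finite) tensor"
  obtains a b c where "T = (\<Sum>l<tensor_rank T. tensor3 (a l) (b l) (c l))"
proof -
  let ?f = "\<lambda>(i, j, k). (axis i (T $ i $ j $ k), basis_vec j, basis_vec k)"
  obtain ps :: "('a \<times> 'b \<times> 'c) list" where ps: "set ps = UNIV" "distinct ps"
    using finite_distinct_list[OF finite_class.finite_UNIV] by blast
  define L where "L = map ?f ps"
  have "(\<Sum>(a, b, c)\<leftarrow>L. tensor3 a b c)
      = (\<Sum>(i, j, k)\<in>UNIV. tensor3 (axis i (T $ i $ j $ k)) (basis_vec j) (basis_vec k))"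
    using ps by (simp add: L_def sum_list_distinct_conv_sum_set o_def case_prod_unfold)
  also have "\<dots> = T"
  proof -
    have "(\<Sum>(i, j, k)\<in>UNIV. tensor3 (axis i (T $ i $ j $ k)) (basis_vec j) (basis_vec k)) $ i' $ j' $ k'
        = (\<Sum>p\<in>UNIV. if p = (i', j', k') then T $ i' $ j' $ k' else 0)" for i' j' k'
      unfolding sum_component
      by (rule sum.cong) (auto simp: tensor3_def axis_def split: if_splits)
    then show ?thesis
      by (simp add: vec_eq_iff)
  qed
  finally have "T = (\<Sum>(a, b, c)\<leftarrow>L. tensor3 a b c)"
    by (rule sym)
  from this[unfolded tensor_decomposition_list]
  have "\<exists>(r::nat) a b c. T = (\<Sum>l<r. tensor3 (a l) (b l) (c l))"
    by (intro exI)
  from LeastI_ex[OF this] that show ?thesis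
    unfolding tensor_rank_def by blast
qed

section \<open>Contraction, determinants and dual vectors\<close>

lemma contract_nth: "contract T x $ j $ k = (\<Sum>i\<in>UNIV. x $ i * T $ i $ j $ k)"
  by (simp add: contract_def)

lemma contract_sum_tensor3:
  "contract (\<Sum>l\<in>S. tensor3 (a l) (b l) (c l)) x $ j $ k
     = (\<Sum>l\<in>S. (\<Sum>i\<in>UNIV. x $ i * a l $ i) * b l $ j * c l $ k)"
  unfolding contract_def sum_component tensor3_def
  by (simp add: sum_distrib_left sum_distrib_right mult_ac) (rule sum.swap)

lemma rank_eq_card_iff_det_nonzero:
  fixes A :: "complex^'n::finite^'n"
  shows "rank A = CARD('n) \<longleftrightarrow> det A \<noteq> 0"
proof -
  have "rank A = CARD('n) \<longleftrightarrow> vec.span (rows A) = UNIV"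
    unfolding row_rank_def_gen
    using vec.dim_eq_full[of "rows A"] by (simp add: vec.dimension_def card_cart_basis)
  also have "\<dots> \<longleftrightarrow> det A \<noteq> 0"
    unfolding matrix_left_invertible_span_rows_gen[symmetric] invertible_det_nz[symmetric]
      invertible_left_inverse ..
  finally show ?thesis .
qed

lemma det_nonzero_inverse:
  fixes A :: "complex^'n::finite^'n"
  assumes "det A \<noteq> 0"
  shows "A ** matrix_inv A = mat 1" "matrix_inv A ** A = mat 1"
proof -
  have "\<exists>B. A ** B = mat 1 \<and> B ** A = mat 1"
    using assms by (simp add: invertible_def flip: invertible_det_nz)
  from someI_ex[OF this] show "A ** matrix_inv A = mat 1" "matrix_inv A ** A = mat 1"
    by (simp_all add: matrix_inv_def)
qed

text \<open>Take a basis containing \<open>B\<close> as the rows of \<open>W\<close>; the columns of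
  the inverse of \<open>W\<close> form the dual basis.\<close>

lemma dual_vector:
  fixes B :: "(complex^'n::finite) set"
  assumes "vec.independent B" "b \<in> B"
  obtains z where "(\<Sum>i\<in>UNIV. z $ i * b $ i) = 1"
    "\<And>b'. b' \<in> B - {b} \<Longrightarrow> (\<Sum>i\<in>UNIV. z $ i * b' $ i) = 0"
proof -
  let ?E = "vec.extend_basis B"
  have ind: "vec.independent ?E" and span: "vec.span ?E = UNIV" and sub: "B \<subseteq> ?E"
    using assms(1) by (auto simp: vec.independent_extend_basis vec.extend_basis_superset)
  have "card ?E = CARD('n)"
    using vec.dim_eq_card[OF _ ind, of UNIV] span by (simp add: card_cart_basis)
  moreover have "finite ?E"
    using ind vec.finiteI_independent by blast
  ultimately obtain f where f: "bij_betw f (UNIV :: 'n set) ?E"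
    using finite_same_card_bij[of "UNIV :: 'n set" ?E] by auto
  define W :: "complex^'n^'n" where "W = (\<chi> i. f i)"
  have "rows W = ?E"
    using f by (auto simp: rows_def row_def W_def bij_betw_def vec_nth_inverse)
  then obtain V where "V ** W = mat 1"
    using span matrix_left_invertible_span_rows_gen[of W] by auto
  then have WV: "W ** V = mat 1"
    using matrix_left_right_inverse by blast
  obtain k where k: "f k = b"
    using f assms(2) sub by (force simp: bij_betw_def)
  let ?z = "\<chi> i. V $ i $ k"
  have *: "(\<Sum>i\<in>UNIV. ?z $ i * f m $ i) = (if m = k then 1 else 0)" for m
  proof -
    have "(W ** V) $ m $ k = (if m = k then 1 else 0)"
      unfolding WV by (simp add: mat_def)
    then show ?thesis
      by (simp add: matrix_matrix_mult_def W_def mult.commute)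
  qed
  show ?thesis
  proof
    show "(\<Sum>i\<in>UNIV. ?z $ i * b $ i) = 1"
      using *[of k] k by simp
    fix b' assume b': "b' \<in> B - {b}"
    then obtain m where "f m = b'"
      using f sub by (force simp: bij_betw_def)
    then show "(\<Sum>i\<in>UNIV. ?z $ i * b' $ i) = 0"
      using *[of m] k b' by auto
  qed
qed

text \<open>
  The substitution method: some covector with \<open>\<alpha> $ i\<^sub>0 = 1\<close> annihilates \<open>CARD('a) - 1\<close> of
  the terms of any decomposition, and the remaining ones must still span an invertible matrix.
\<close>

lemma tensor_rank_ge:
  fixes T :: "('a::finite, 'm::finite, 'm) tensor"
  assumes "A_concise T" and det: "\<And>\<alpha>. \<alpha> $ i\<^sub>0 = 1 \<Longrightarrow> det (contract T \<alpha>) \<noteq> 0"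
  shows "CARD('a) + CARD('m) - 1 \<le> tensor_rank T"
proof -
  define r where "r = tensor_rank T"
  obtain a b c where T: "T = (\<Sum>l<r. tensor3 (a l) (b l) (c l))"
    using tensor_rank_attained[of T] r_def by blast
  let ?e = "basis_vec i\<^sub>0 :: complex^'a"
  have "vec.independent {?e}"
    by (simp add: axis_eq_0_iff)
  then obtain B where B: "{?e} \<subseteq> B" "B \<subseteq> insert ?e (a ` {..<r})" "vec.independent B"
      "insert ?e (a ` {..<r}) \<subseteq> vec.span B"
    using vec.maximal_independent_subset_extend[of "{?e}" "insert ?e (a ` {..<r})"] by auto
  \<comment> \<open>Otherwise a nonzero covector annihilates every \<open>a l\<close>, contradicting
    conciseness.\<close>
  have span: "vec.span B = UNIV"
  proof (rule ccontr)
    assume "vec.span B \<noteq> UNIV"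
    then obtain v where v: "v \<notin> vec.span B" by blast
    then have "v \<notin> B"
      using vec.span_base by blast
    obtain z where z: "(\<Sum>i\<in>UNIV. z $ i * v $ i) = 1"
      "\<And>b'. b' \<in> insert v B - {v} \<Longrightarrow> (\<Sum>i\<in>UNIV. z $ i * b' $ i) = 0"
      using dual_vector[OF vec.independent_insertI[OF v B(3)], of v] by blast
    have "vec.subspace {x. (\<Sum>i\<in>UNIV. z $ i * x $ i) = 0}"
      by (auto simp: vec.subspace_def algebra_simps sum.distrib simp flip: sum_distrib_left)
    then have "vec.span B \<subseteq> {x. (\<Sum>i\<in>UNIV. z $ i * x $ i) = 0}"
      using z(2) \<open>v \<notin> B\<close> by (intro vec.span_minimal) auto
    then have "(\<Sum>i\<in>UNIV. z $ i * a l $ i) = 0" if "l < r" for l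
      using B(4) that by auto
    then have "contract T z = contract T 0"
      by (simp add: T vec_eq_iff contract_sum_tensor3)
    then have "z = 0"
      using assms(1) by (auto simp: A_concise_def inj_def)
    with z(1) show False by simp
  qed
  have card_B: "card B = CARD('a)"
    using vec.dim_eq_card[OF _ B(3), of UNIV] span by (simp add: card_cart_basis)
  \<comment> \<open>The covector dual to \<open>?e\<close> kills the rest of the basis
    \<open>B\<close>, which consists of vectors \<open>a l\<close>.\<close>
  obtain \<alpha> where \<alpha>: "(\<Sum>i\<in>UNIV. \<alpha> $ i * ?e $ i) = 1"
      "\<And>b'. b' \<in> B - {?e} \<Longrightarrow> (\<Sum>i\<in>UNIV. \<alpha> $ i * b' $ i) = 0"
    using dual_vector[OF B(3), of ?e] B(1) by blast
  have "\<alpha> $ i\<^sub>0 = 1"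
    using \<alpha>(1) by (simp add: axis_def if_distrib cong: if_cong)
  define L where "L = {l. l < r \<and> a l \<in> B - {?e}}"
  have L: "finite L" "L \<subseteq> {..<r}"
    by (auto simp: L_def)
  have "card (B - {?e}) \<le> card L"
    using B(2) L(1) by (intro surj_card_le[of _ _ a]) (auto simp: L_def)
  then have card_L: "CARD('a) - 1 \<le> card L"
    using B(1) card_B by simp
  let ?C = "c ` ({..<r} - L)"
  have "contract T \<alpha> $ j \<in> vec.span ?C" for j
  proof -
    have "contract T \<alpha> $ j = (\<Sum>l\<in>{..<r} - L. ((\<Sum>i\<in>UNIV. \<alpha> $ i * a l $ i) * b l $ j) *s c l)"
      using \<alpha>(2) unfolding T vec_eq_iff contract_sum_tensor3 sum_component
      by (auto simp: L_def intro!: sum.mono_neutral_cong_right)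
    moreover have "\<dots> \<in> vec.span ?C"
      by (intro vec.span_sum vec.span_scale vec.span_base imageI)
    ultimately show ?thesis
      by simp
  qed
  then have "rank (contract T \<alpha>) \<le> card ?C"
    unfolding row_rank_def_gen by (intro vec.dim_le_card) (auto simp: rows_def row_def)
  also have "\<dots> \<le> card ({..<r} - L)"
    by (rule card_image_le) simp
  also have "\<dots> = r - card L"
    using L by (simp add: card_Diff_subset)
  finally have "CARD('m) \<le> r - card L"
    using det[OF \<open>\<alpha> $ i\<^sub>0 = 1\<close>] rank_eq_card_iff_det_nonzero[of "contract T \<alpha>"] by simp
  moreover have "card L \<le> r"
    using card_mono[OF _ L(2)] by simp
  moreover have "0 < CARD('m)"
    by simp
  ultimately show ?thesis
    using card_L unfolding r_def by linarith
qed

subsection \<open>The tensor \<open>T_Leit5\<close> and its rank\<close>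

lemma contract_T_Leit5:
  "contract T_Leit5 x =
     vector [vector [x$1, 0, x$2, x$3, 0],
             vector [0, x$1, 0, x$4, x$5],
             vector [0, 0, x$1, 0, x$2],
             vector [0, 0, 0, x$1, 0],
             vector [0, 0, 0, 0, x$1]]"
  by (simp add: vec_eq_iff forall_5 sum_5 vector_5 contract_def T_Leit5_def Let_def tensor3_def axis_def)

lemma contract_T_Leit5_transpose:
  "transpose (contract T_Leit5 x) =
           vector [vector [x$1, 0,   0,   0,   0],
                   vector [0,   x$1, 0,   0,   0],
                   vector [x$2, 0,   x$1, 0,   0],
                   vector [x$3, x$4, 0,   x$1, 0],
                   vector [0,   x$5, x$2, 0,   x$1]]"
  by (simp add: vec_eq_iff forall_5 vector_5 transpose_def contract_T_Leit5)

lemma A_concise_T_Leit5: "A_concise T_Leit5"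
  by (simp add: A_concise_def inj_def vec_eq_iff forall_5 vector_5 contract_T_Leit5)

lemma det_contract_T_Leit5:
  assumes "x $ 1 \<noteq> 0"
  shows "det (contract T_Leit5 x) \<noteq> 0"
proof -
  have "v = 0" if "contract T_Leit5 x *v v = 0" for v
    using that assms
    by (auto simp: vec_eq_iff forall_5 vector_5 sum_5 contract_T_Leit5 matrix_vector_mult_def)
  then show ?thesis
    unfolding invertible_det_nz[symmetric] invertible_left_inverse matrix_left_invertible_ker
    by blast
qed

section \<open>The endomorphisms of \<open>T_Leit5\<close>: commuting, but not closed under
  composition\<close>

lemma contract_T_Leit5_axis_1: "contract T_Leit5 (axis 1 1) = mat 1"
  by (simp add: vec_eq_iff forall_5 vector_5 contract_T_Leit5 axis_def mat_def)

lemma matrix_inv_mat_1: "matrix_inv (mat 1) = (mat 1 :: complex^'n::finite^'n)"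
  using det_nonzero_inverse[of "mat 1 :: complex^'n^'n"] by (simp add: matrix_mul_lid)

lemma Espace_T_Leit5: "Espace T_Leit5 (axis 1 1) = range (contract T_Leit5)"
  by (auto simp: Espace_def contract_T_Leit5_axis_1 matrix_inv_mat_1)

lemma module_map_matrix: "module (\<lambda>c. map_matrix ((*) (c::complex)) :: complex^'n::finite^'n \<Rightarrow> _)"
  by unfold_locales (simp_all add: vec_eq_iff algebra_simps)

lemma abelian_T_Leit5: "abelian_lie_subalgebra (Espace T_Leit5 (axis 1 1))"
proof -
  have zero: "contract T_Leit5 0 = 0"
    and add: "contract T_Leit5 x + contract T_Leit5 y = contract T_Leit5 (x + y)"
    and scale: "map_matrix ((*) c) (contract T_Leit5 x) = contract T_Leit5 (c *s x)" for x y c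
    by (simp_all add: contract_def vec_eq_iff algebra_simps sum.distrib sum_distrib_left)
  have "module.subspace (\<lambda>c. map_matrix ((*) c)) (range (contract T_Leit5))"
    unfolding module.subspace_def[OF module_map_matrix]
    by (auto simp: add scale) (metis zero rangeI)
  moreover have "lie_bracket (contract T_Leit5 x) (contract T_Leit5 y) = 0" for x y
    by (simp add: lie_bracket_def matrix_matrix_mult_def contract_T_Leit5
        vec_eq_iff forall_5 sum_5 vector_5)
  ultimately show ?thesis
    unfolding abelian_lie_subalgebra_def lie_subalgebra_def Espace_T_Leit5
    by (auto intro: image_eqI[of _ _ 0] simp: zero)
qed

text \<open>
  With \<open>N\<close> the matrix of the second covector, the entry \<open>(1, 5)\<close> of \<open>N ** R ** N\<close> is
  \<open>R $ 3 $ 3\<close>, whereas it vanishes on the whole space of matrices.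
\<close>

lemma not_closed_T_Leit5:
  assumes "rank (contract T_Leit5 \<alpha>) = 5"
  shows "\<not> closed_under_composition (Espace T_Leit5 \<alpha>)"
proof
  assume closed: "closed_under_composition (Espace T_Leit5 \<alpha>)"
  let ?M = "contract T_Leit5 \<alpha>" and ?N = "contract T_Leit5 (axis 2 1)"
  define R where "R = matrix_inv ?M"
  have "det ?M \<noteq> 0"
    using assms rank_eq_card_iff_det_nonzero[of ?M] by simp
  note inv = det_nonzero_inverse[OF this, folded R_def]
  have "?N ** R \<in> Espace T_Leit5 \<alpha>"
    by (auto simp: Espace_def R_def)
  then have "?N ** R ** (?N ** R) \<in> Espace T_Leit5 \<alpha>"
    using closed by (auto simp: closed_under_composition_def)
  then obtain z where "?N ** R ** (?N ** R) = contract T_Leit5 z ** R"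
    by (auto simp: Espace_def R_def)
  then have "?N ** R ** (?N ** R) ** ?M = contract T_Leit5 z ** R ** ?M"
    by (rule arg_cong)
  then have "?N ** R ** ?N = contract T_Leit5 z"
    by (simp add: inv flip: matrix_mul_assoc)
  then have "(?N ** R ** ?N) $ 1 $ 5 = contract T_Leit5 z $ 1 $ 5"
    by simp
  then have R33: "R $ 3 $ 3 = 0"
    by (simp add: matrix_matrix_mult_def sum_5 contract_T_Leit5 vector_5 axis_def)
  \<comment> \<open>The last equation makes the diagonal entry of \<open>?M\<close> nonzero, the
    second then gives \<open>R $ 5 $ 3 = 0\<close>, so the first forces \<open>R $ 3 $ 3\<close> to
    be nonzero.\<close>
  have "(?M ** R) $ 3 $ 3 = 1" "(?M ** R) $ 5 $ 3 = 0" "(?M ** R) $ 5 $ 5 = 1"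
    by (simp_all add: inv mat_def)
  with R33 show False
    by (auto simp: matrix_matrix_mult_def sum_5 contract_T_Leit5 vector_5)
qed

lemma rank_contract_T_Leit5_axis_1: "rank (contract T_Leit5 (axis 1 1)) = 5"
  using rank_eq_card_iff_det_nonzero[of "contract T_Leit5 (axis 1 1)"]
  by (simp add: contract_T_Leit5_axis_1)

lemma T_Leit5_in_Abel_A: "T_Leit5 \<in> Abel_A"
  using A_concise_T_Leit5 rank_contract_T_Leit5_axis_1 abelian_T_Leit5
  by (auto simp: Abel_A_def)

lemma T_Leit5_notin_End_Abel_A: "T_Leit5 \<notin> End_Abel_A"
  using not_closed_T_Leit5 by (auto simp: End_Abel_A_def)

text \<open>
  On the indices 1, 3, 5 the first two slices form the pencil of a nilpotent Jordan block; adding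
  one entry to that block makes its eigenvalues 0, 1 and -1.
\<close>

lemma tensor_rank_T_Leit5: "tensor_rank T_Leit5 = 9"
proof (rule antisym)
  let ?e = "basis_vec :: 5 \<Rightarrow> complex^5"
  \<comment> \<open>The first three terms belong to the eigenvalues 0, 1, -1; the fourth cancels the
    added entry (5, 3). The other five are terms of \<open>T_Leit5\<close> itself.\<close>
  let ?L = "[(?e 1, ?e 1, ?e 1 - ?e 5),
    ((1/2) *s (?e 1 + ?e 2), ?e 1 + ?e 3 + ?e 5, ?e 3 + ?e 5),
    ((1/2) *s (?e 1 - ?e 2), ?e 1 - ?e 3 + ?e 5, ?e 5 - ?e 3),
    (- ?e 2, ?e 5, ?e 3),
    (?e 1, ?e 2, ?e 2),
    (?e 1, ?e 4, ?e 4),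
    (?e 3, ?e 1, ?e 4),
    (?e 4, ?e 2, ?e 4),
    (?e 5, ?e 2, ?e 5)]"
  have "T_Leit5 = (\<Sum>(a, b, c)\<leftarrow>?L. tensor3 a b c)"
    by (simp add: vec_eq_iff forall_5 T_Leit5_def Let_def tensor3_def axis_def)
  from tensor_rank_le[OF this] show "tensor_rank T_Leit5 \<le> 9"
    by simp
  show "9 \<le> tensor_rank T_Leit5"
    using tensor_rank_ge[OF A_concise_T_Leit5, of 1] by (simp add: det_contract_T_Leit5)
qed

subsection \<open>Polynomials vanishing on tensors of small rank\<close>

text \<open>Here \<open>contract X x = B ** diag (A *v x) ** C\<close>. If \<open>A\<close> is
  singular, a kernel vector gives the first case. Otherwise \<open>C ** R ** B\<close> is inverse to
  \<open>diag (A *v e)\<close>, hence diagonal, so the product is \<open>B ** diag u ** C\<close>,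
  and \<open>u\<close> lies in the range of \<open>A\<close>.\<close>

lemma rank_one_decomposition_dichotomy:
  fixes a b c :: "'m::finite \<Rightarrow> complex^'m"
  defines "X \<equiv> \<Sum>l\<in>UNIV. tensor3 (a l) (b l) (c l)"
  assumes R: "contract X e ** R = mat 1"
  shows "(\<exists>z. z \<noteq> 0 \<and> contract X z = 0) \<or> (\<exists>z. contract X x ** R ** contract X y = contract X z)"
proof -
  define A where "A = (\<chi> l i. a l $ i)"
  define B where "B = (\<chi> j l. b l $ j)"
  define C where "C = (\<chi> l k. c l $ k)"
  define diag :: "complex^'m \<Rightarrow> complex^'m^'m" where "diag v = (\<chi> i j. if i = j then v $ i else 0)" for v
  have diag_mult: "(diag v ** M) $ i $ j = v $ i * M $ i $ j" for v i j and M :: "complex^'m^'m"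
    by (simp add: diag_def matrix_matrix_mult_def if_distrib if_distribR cong: if_cong)
  have diag_diag: "diag v ** diag v' = diag (\<chi> i. v $ i * v' $ i)" for v v'
    unfolding vec_eq_iff diag_mult by (simp add: diag_def)
  have X: "contract X x = B ** diag (A *v x) ** C" for x
  proof -
    have "contract X x $ j $ k = (B ** (diag (A *v x) ** C)) $ j $ k" for j k
      unfolding matrix_matrix_mult_def[of B] vec_lambda_beta diag_mult X_def contract_sum_tensor3
      by (simp add: A_def B_def C_def matrix_vector_mult_def mult_ac)
    then show ?thesis
      by (simp add: vec_eq_iff matrix_mul_assoc)
  qed
  show ?thesis
  proof (cases "det A = 0")
    case True
    then have "\<not> (\<exists>A'. A' ** A = mat 1)"
      by (metis invertible_det_nz invertible_left_inverse)
    then obtain z where "z \<noteq> 0" "A *v z = 0"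
      by (auto simp: matrix_left_invertible_ker)
    moreover have "diag 0 = 0"
      by (simp add: diag_def vec_eq_iff)
    ultimately have "contract X z = 0"
      by (simp add: X)
    with \<open>z \<noteq> 0\<close> show ?thesis by blast
  next
    case False
    define w where "w = A *v e"
    define W where "W = C ** R ** B"
    have "B ** (diag w ** C ** R) = mat 1"
      using R by (simp add: X w_def matrix_mul_assoc)
    then have "diag w ** C ** R ** B = mat 1"
      using matrix_left_right_inverse by blast
    then have "diag w ** W = mat 1"
      by (simp add: W_def matrix_mul_assoc)
    then have W: "w $ i * W $ i $ j = (if i = j then 1 else 0)" for i j
      unfolding diag_mult[symmetric] by (simp add: mat_def)
    have w: "w $ i \<noteq> 0" for i
      using W[of i i] by force
    define u where "u = (\<chi> i. (A *v x) $ i * (A *v y) $ i / w $ i)"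
    have "W $ i $ j = diag (\<chi> i. 1 / w $ i) $ i $ j" for i j
      using W[of i j] w[of i] by (auto simp: diag_def field_simps)
    then have "W = diag (\<chi> i. 1 / w $ i)"
      by (simp add: vec_eq_iff)
    then have "diag (A *v x) ** W ** diag (A *v y) = diag u"
      by (simp add: diag_diag u_def)
    moreover have "A *v (matrix_inv A *v u) = u"
      using det_nonzero_inverse[OF False] by (simp add: matrix_vector_mul_assoc)
    moreover have "contract X x ** R ** contract X y
        = B ** (diag (A *v x) ** W ** diag (A *v y)) ** C"
      by (simp add: X W_def matrix_mul_assoc)
    ultimately have "contract X x ** R ** contract X y = contract X (matrix_inv A *v u)"
      by (simp add: X)
    then show ?thesis by blast
  qed
qed

text \<open>Cramer's column replacement keeps the entries polynomial in \<open>A\<close>, unlike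
  those of \<open>matrix_inv\<close>.\<close>

definition adjugate :: "complex^'n::finite^'n \<Rightarrow> complex^'n^'n" where
  "adjugate A = (\<chi> j k. det (\<chi> i l. if l = j then basis_vec k $ i else A $ i $ l))"

lemma adjugate_eq:
  assumes "A ** R = mat 1"
  shows "adjugate A = (\<chi> j k. det A * R $ j $ k)"
proof -
  have "(A *v column k R) $ i = (A ** R) $ i $ k" for i k
    by (simp add: matrix_vector_mult_def column_def matrix_matrix_mult_def)
  then have *: "A *v column k R = basis_vec k" for k
    by (simp add: assms vec_eq_iff mat_def axis_def)
  then show ?thesis
    using cramer_lemma[of _ A "column _ R", unfolded *]
    by (simp add: adjugate_def vec_eq_iff column_def mult.commute)
qed

text \<open>
  If the matrices \<open>X\<^sub>i\<close> of \<open>X\<close> and \<open>X(x) adj(X(e)) X(y)\<close> are linearly dependent, then so are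
  the rows of the matrix listing their entries at the positions \<open>pos\<close>.
\<close>

definition composition_minor ::
  "complex^'m \<Rightarrow> complex^'m \<Rightarrow> complex^'m \<Rightarrow> ('m option \<Rightarrow> 'm \<times> 'm) \<Rightarrow> ('m::finite, 'm, 'm) tensor \<Rightarrow> complex"
where
  "composition_minor e x y pos X = det (contract X e) *
     det (\<chi> r s. (case r of None \<Rightarrow> contract X x ** adjugate (contract X e) ** contract X y
                   | Some i \<Rightarrow> X $ i) $ fst (pos s) $ snd (pos s))"

lemma composition_minor_eq_0:
  fixes X :: "('m::finite, 'm, 'm) tensor"
  assumes "tensor_rank X \<le> CARD('m)"
  shows "composition_minor e x y pos X = 0"
proof (cases "det (contract X e) = 0")
  \<comment> \<open>The leading determinant factor disposes of the case in which
    \<open>contract X e\<close> has no inverse.\<close>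
  case True
  then show ?thesis by (simp add: composition_minor_def)
next
  case False
  define R where "R = matrix_inv (contract X e)"
  note R = det_nonzero_inverse(1)[OF False, folded R_def]
  define G where "G = (\<chi> r s. (case r of None \<Rightarrow> contract X x ** adjugate (contract X e) ** contract X y
                   | Some i \<Rightarrow> X $ i) $ fst (pos s) $ snd (pos s))"
  obtain a b c where X: "X = (\<Sum>l<tensor_rank X. tensor3 (a l) (b l) (c l))"
    by (rule tensor_rank_attained)
  obtain f where f: "bij_betw f (UNIV :: 'm set) {..<CARD('m)}"
    using finite_same_card_bij[of "UNIV :: 'm set" "{..<CARD('m)}"] by auto
  \<comment> \<open>Zero terms pad the decomposition to exactly \<open>CARD('m)\<close> terms, so
    that it can be indexed by \<open>'m\<close>.\<close>
  let ?a = "\<lambda>l. if l < tensor_rank X then a l else 0"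
  have "X = (\<Sum>l<CARD('m). tensor3 (?a l) (b l) (c l))"
    by (subst X, rule sum.mono_neutral_cong_left) (use assms in \<open>auto simp: tensor3_def vec_eq_iff\<close>)
  also have "\<dots> = (\<Sum>l\<in>UNIV. tensor3 (?a (f l)) (b (f l)) (c (f l)))"
    by (rule sum.reindex_bij_betw[OF f, symmetric])
  finally have X': "X = (\<Sum>l\<in>UNIV. tensor3 (?a (f l)) (b (f l)) (c (f l)))" .
  have "\<exists>w. w \<noteq> 0 \<and> (\<forall>s. (\<Sum>r\<in>UNIV. w $ r * G $ r $ s) = 0)"
    using rank_one_decomposition_dichotomy[of "\<lambda>l. ?a (f l)" "\<lambda>l. b (f l)" "\<lambda>l. c (f l)" e R x y,
        folded X', OF R]
  proof
    assume "\<exists>z. z \<noteq> 0 \<and> contract X z = 0"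
    then obtain z where z: "z \<noteq> 0" "contract X z = 0" by blast
    let ?w = "\<chi> r. case r of None \<Rightarrow> 0 | Some i \<Rightarrow> z $ i"
    have "?w \<noteq> 0"
      using z(1) by (auto simp: vec_eq_iff split: option.split)
    moreover have "(\<Sum>r\<in>UNIV. ?w $ r * G $ r $ s) = 0" for s
    proof -
      have "contract X z $ fst (pos s) $ snd (pos s) = 0"
        by (simp add: z)
      then show ?thesis
        by (simp add: UNIV_option_conv sum.reindex G_def contract_def)
    qed
    ultimately show ?thesis by blast
  next
    assume "\<exists>z. contract X x ** R ** contract X y = contract X z"
    then obtain z where z: "contract X x ** R ** contract X y = contract X z" by blast
    have Q: "contract X x ** adjugate (contract X e) ** contract X y
        = (\<chi> j k. det (contract X e) * contract X z $ j $ k)"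
      unfolding adjugate_eq[OF R] z[symmetric]
      by (simp add: vec_eq_iff matrix_matrix_mult_def sum_distrib_left sum_distrib_right mult_ac)
    \<comment> \<open>The adjugate is \<open>det (contract X e)\<close> times \<open>R\<close>, so
      this factor reappears in the coefficients of the relation between row \<open>None\<close> and
      the slices.\<close>
    let ?w = "\<chi> r. case r of None \<Rightarrow> - 1 | Some i \<Rightarrow> det (contract X e) * z $ i"
    have "?w $ None \<noteq> 0"
      by simp
    then have "?w \<noteq> 0"
      by (metis zero_index)
    moreover have "(\<Sum>r\<in>UNIV. ?w $ r * G $ r $ s) = 0" for s
    proof -
      have "G $ None $ s = det (contract X e) * contract X z $ fst (pos s) $ snd (pos s)"
        by (simp add: G_def Q)
      also have "\<dots> = (\<Sum>i\<in>UNIV. det (contract X e) * z $ i * G $ Some i $ s)"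
        by (simp add: G_def contract_nth sum_distrib_left mult_ac)
      finally show ?thesis
        by (simp add: UNIV_option_conv sum.reindex)
    qed
    ultimately show ?thesis by blast
  qed
  then obtain w where w: "w \<noteq> 0" "w v* G = 0"
    by (auto simp: vector_matrix_mult_def vec_eq_iff mult.commute)
  have "det G = 0"
  proof (rule ccontr)
    assume "det G \<noteq> 0"
    then have "w v* (G ** matrix_inv G) = w"
      using det_nonzero_inverse(1)[of G] by simp
    with w show False
      by (metis vector_matrix_mul_assoc vector_matrix_mult_0)
  qed
  then show ?thesis
    by (simp add: composition_minor_def G_def)
qed

section \<open>Polynomiality of the minors, and their vanishing on \<open>Diag_A\<close>\<close>

lemma tensor_polynomials_sum:
  "(\<And>i. i \<in> I \<Longrightarrow> p i \<in> tensor_polynomials) \<Longrightarrow> (\<lambda>T. \<Sum>i\<in>I. p i T) \<in> tensor_polynomials"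
  by (induction I rule: infinite_finite_induct) (auto intro: tensor_polynomials.intros)

lemma tensor_polynomials_prod:
  "(\<And>i. i \<in> I \<Longrightarrow> p i \<in> tensor_polynomials) \<Longrightarrow> (\<lambda>T. \<Prod>i\<in>I. p i T) \<in> tensor_polynomials"
  by (induction I rule: infinite_finite_induct) (auto intro: tensor_polynomials.intros)

lemma tensor_polynomials_det:
  fixes M :: "('a::finite, 'b::finite, 'c::finite) tensor \<Rightarrow> complex^'n::finite^'n"
  assumes "\<And>i j. (\<lambda>T. M T $ i $ j) \<in> tensor_polynomials"
  shows "(\<lambda>T. det (M T)) \<in> tensor_polynomials"
  unfolding det_def
  by (intro tensor_polynomials_sum tensor_polynomials.mult tensor_polynomials.const
      tensor_polynomials_prod assms)

lemma tensor_polynomials_matrix_mult: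
  assumes "\<And>i j. (\<lambda>T. M T $ i $ j) \<in> tensor_polynomials"
    and "\<And>i j. (\<lambda>T. N T $ i $ j) \<in> tensor_polynomials"
  shows "(\<lambda>T. (M T ** N T) $ i $ j) \<in> tensor_polynomials"
  unfolding matrix_matrix_mult_def vec_lambda_beta
  by (intro tensor_polynomials_sum tensor_polynomials.mult assms)

lemma tensor_polynomials_contract: "(\<lambda>T. contract T x $ j $ k) \<in> tensor_polynomials"
  unfolding contract_def vec_lambda_beta
  by (intro tensor_polynomials_sum tensor_polynomials.intros)

lemma tensor_polynomials_adjugate:
  assumes "\<And>i j. (\<lambda>T. M T $ i $ j) \<in> tensor_polynomials"
  shows "(\<lambda>T. adjugate (M T) $ i $ j) \<in> tensor_polynomials"
  unfolding adjugate_def vec_lambda_beta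
proof (rule tensor_polynomials_det)
  fix i' j'
  show "(\<lambda>T. (\<chi> i' l. if l = i then basis_vec j $ i' else M T $ i' $ l) $ i' $ j') \<in> tensor_polynomials"
    by (cases "j' = i") (simp_all add: assms tensor_polynomials.const)
qed

lemma composition_minor_polynomial: "composition_minor e x y pos \<in> tensor_polynomials"
  unfolding composition_minor_def[abs_def]
proof (intro tensor_polynomials.mult tensor_polynomials_det tensor_polynomials_contract)
  fix r s
  show "(\<lambda>X. (\<chi> r s. (case r of None \<Rightarrow> contract X x ** adjugate (contract X e) ** contract X y
      | Some i \<Rightarrow> X $ i) $ fst (pos s) $ snd (pos s)) $ r $ s) \<in> tensor_polynomials"
    by (cases r) (auto intro!: tensor_polynomials_matrix_mult tensor_polynomials_adjugate
        tensor_polynomials_contract tensor_polynomials.coord)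
qed

lemma tensor_polynomials_tendsto:
  assumes "p \<in> tensor_polynomials" "(X \<longlongrightarrow> T) F"
  shows "((\<lambda>n. p (X n)) \<longlongrightarrow> p T) F"
  using assms(1) by induction (auto intro!: tendsto_intros assms(2))

text \<open>In a common eigenbasis \<open>P\<close> each \<open>D x\<close> is diagonal. The
  \<open>l\<close>-th term of the decomposition combines the \<open>l\<close>-th eigenvalue as a
  linear form in \<open>x\<close>, the \<open>l\<close>-th column of \<open>P\<close> and the
  \<open>l\<close>-th row of \<open>matrix_inv P ** M\<close>.\<close>

lemma tensor_rank_le_if_simultaneously_diagonalizable:
  fixes T :: "('m::finite, 'm, 'm) tensor"
  assumes "rank (contract T \<alpha>) = CARD('m)" "simultaneously_diagonalizable (Espace T \<alpha>)"
  shows "tensor_rank T \<le> CARD('m)"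
proof -
  define M where "M = contract T \<alpha>"
  have "det M \<noteq> 0"
    using assms(1) rank_eq_card_iff_det_nonzero M_def by metis
  note M = det_nonzero_inverse[OF this]
  obtain P :: "complex^'m^'m" where P: "invertible P"
    and "\<forall>X\<in>Espace T \<alpha>. \<forall>i j. i \<noteq> j \<longrightarrow> (matrix_inv P ** X ** P) $ i $ j = 0"
    using assms(2) by (auto simp: simultaneously_diagonalizable_def)
  moreover define D where "D x = matrix_inv P ** (contract T x ** matrix_inv M) ** P" for x
  ultimately have D: "D x $ i $ j = 0" if "i \<noteq> j" for x i j
    using that by (auto simp: Espace_def M_def)
  have T: "contract T x = P ** D x ** (matrix_inv P ** M)" for x
  proof -
    have "P ** D x ** (matrix_inv P ** M)
        = (P ** matrix_inv P) ** contract T x ** matrix_inv M ** (P ** matrix_inv P) ** M"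
      by (simp add: D_def matrix_mul_assoc)
    also have "\<dots> = contract T x ** (matrix_inv M ** M)"
      using det_nonzero_inverse[of P] P by (simp add: matrix_mul_assoc invertible_det_nz)
    finally show ?thesis
      by (simp add: M)
  qed
  have PD: "(P ** D x) $ j $ l = P $ j $ l * D x $ l $ l" for x j l
  proof -
    have "(P ** D x) $ j $ l = (\<Sum>h\<in>UNIV. if h = l then P $ j $ l * D x $ l $ l else 0)"
      unfolding matrix_matrix_mult_def vec_lambda_beta by (rule sum.cong) (auto simp: D)
    then show ?thesis by simp
  qed
  let ?t = "\<lambda>l. (\<chi> i. D (axis i 1) $ l $ l, \<chi> j. P $ j $ l, (matrix_inv P ** M) $ l)"
  obtain ls :: "'m list" where ls: "set ls = UNIV" "distinct ls"
    using finite_distinct_list[OF finite_class.finite_UNIV] by blast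
  have "T = (\<Sum>l\<in>UNIV. tensor3 (fst (?t l)) (fst (snd (?t l))) (snd (snd (?t l))))"
  proof -
    have "T $ i $ j $ k = (\<Sum>l\<in>UNIV. D (axis i 1) $ l $ l * P $ j $ l * (matrix_inv P ** M) $ l $ k)" for i j k
    proof -
      have "T $ i $ j $ k = contract T (axis i 1) $ j $ k"
        by (simp add: contract_def axis_def if_distrib if_distribR cong: if_cong)
      also have "\<dots> = (\<Sum>l\<in>UNIV. (P ** D (axis i 1)) $ j $ l * (matrix_inv P ** M) $ l $ k)"
        unfolding T by (simp add: matrix_matrix_mult_def[of "P ** _"])
      finally show ?thesis by (simp add: PD mult_ac)
    qed
    then show ?thesis
      by (simp add: vec_eq_iff tensor3_def)
  qed
  also have "\<dots> = (\<Sum>(a, b, c)\<leftarrow>map ?t ls. tensor3 a b c)"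
    using ls by (simp add: sum_list_distinct_conv_sum_set o_def)
  finally have "tensor_rank T \<le> length (map ?t ls)"
    by (rule tensor_rank_le)
  then show ?thesis
    using ls distinct_card[of ls] by simp
qed

lemma Diag_A_composition_minor:
  assumes "T \<in> Diag_A"
  shows "composition_minor e x y pos T = 0"
  using assms composition_minor_polynomial[of e x y pos]
    tensor_rank_le_if_simultaneously_diagonalizable composition_minor_eq_0
  unfolding Diag_A_def zariski_closure_def by blast

subsection \<open>The border rank of \<open>T_Leit5\<close>\<close>

lemma composition_minor_T_Leit5:
  obtains pos where "composition_minor (axis 1 1) (axis 2 1) (axis 2 1) pos T_Leit5 = 1"
proof
  \<comment> \<open>The square of the second slice has its only nonzero entry at (1, 5), where all
    slices vanish. The other positions each pick an entry 1 of one slice at which the other slices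
    and this square vanish, so the matrix is the identity.\<close>
  let ?pos = "\<lambda>s::5 option. case s of None \<Rightarrow> (1, 5)
    | Some i \<Rightarrow> if i = 1 then (1, 1) else if i = 2 then (1, 3) else if i = 3 then (1, 4)
        else if i = 4 then (2, 4) else (2::5, 5::5)"
  have adj: "adjugate (contract T_Leit5 (axis 1 1)) = mat 1"
    unfolding contract_T_Leit5_axis_1 by (subst adjugate_eq[of _ "mat 1"]) (simp_all add: vec_eq_iff)
  have slice: "T_Leit5 $ i = contract T_Leit5 (axis i 1)" for i
    by (simp add: contract_def axis_def vec_eq_iff if_distrib if_distribR cong: if_cong)
  have "(\<chi> r s. (case r of
        None \<Rightarrow> contract T_Leit5 (axis 2 1) ** mat 1 ** contract T_Leit5 (axis 2 1)
      | Some i \<Rightarrow> T_Leit5 $ i) $ fst (?pos s) $ snd (?pos s)) = mat 1"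
    unfolding slice contract_T_Leit5
    by (simp add: vec_eq_iff split_option_all forall_5 vector_5 axis_def mat_def
        matrix_matrix_mult_def sum_5)
  then show "composition_minor (axis 1 1) (axis 2 1) (axis 2 1) ?pos T_Leit5 = 1"
    unfolding composition_minor_def adj by (simp add: contract_T_Leit5_axis_1)
qed

lemma T_Leit5_notin_Diag_A: "T_Leit5 \<notin> Diag_A"
proof
  assume "T_Leit5 \<in> Diag_A"
  obtain pos where "composition_minor (axis 1 1) (axis 2 1) (axis 2 1) pos T_Leit5 = 1"
    by (rule composition_minor_T_Leit5)
  with Diag_A_composition_minor[OF \<open>T_Leit5 \<in> Diag_A\<close>] show False
    by simp
qed

text \<open>Polynomials are continuous, so a minor equal to 1 at the limit is eventually nonzero
  along the sequence.\<close>

lemma eventually_tensor_rank_gt_5: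
  assumes "X \<longlonglongrightarrow> T_Leit5"
  shows "\<forall>\<^sub>F n in sequentially. 5 < tensor_rank (X n)"
proof -
  obtain pos where pos: "composition_minor (axis 1 1) (axis 2 1) (axis 2 1) pos T_Leit5 = 1"
    by (rule composition_minor_T_Leit5)
  let ?p = "composition_minor (axis 1 1) (axis 2 1) (axis 2 1) pos"
  have "(\<lambda>n. ?p (X n)) \<longlonglongrightarrow> ?p T_Leit5"
    by (rule tensor_polynomials_tendsto[OF composition_minor_polynomial assms])
  then have "\<forall>\<^sub>F n in sequentially. ?p (X n) \<noteq> 0"
    by (rule tendsto_imp_eventually_ne) (simp add: pos)
  moreover have "5 < tensor_rank Y" if "?p Y \<noteq> 0" for Y
    using composition_minor_eq_0[of Y] that by force
  ultimately show ?thesis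
    by (auto elim: eventually_mono)
qed

text \<open>
  The matrices \<open>b\<^sub>l c\<^sub>l\<^sup>T\<close> of the six terms degenerate to rank one matrices in
  \<open>\<langle>b\<^sub>1, b\<^sub>2\<rangle> \<otimes> \<langle>c\<^sub>4, c\<^sub>5\<rangle>\<close> satisfying two linear relations; the first-order terms of one
  relation give the second slice, the second-order terms of the other one the identity.
\<close>

lemma T_Leit5_approximation:
  assumes "t \<noteq> 0"
  defines "e \<equiv> \<lambda>i j k. tensor3 (basis_vec i) (basis_vec j) (basis_vec k)"
  shows "tensor_rank (T_Leit5
    + t *\<^sub>R (e 1 5 3 - e 1 4 3 + e 2 1 1 + e 2 3 3 + e 2 4 4 + e 2 5 5 - e 3 1 3 - e 5 3 5)
    + t\<^sup>2 *\<^sub>R (e 1 4 1 - e 2 4 3 + e 2 5 3 + e 3 1 1 + e 3 4 4 + e 4 2 2)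
    + t ^ 3 *\<^sub>R (e 2 4 1 - e 3 4 3)
    + t ^ 4 *\<^sub>R e 3 4 1) \<le> 6" (is "tensor_rank ?T \<le> 6")
proof -
  define s where "s = inverse t"
  let ?b = "basis_vec :: 5 \<Rightarrow> complex^5"
  \<comment> \<open>At \<open>t = 0\<close> the matrices of terms 1 and 2 add up to that of term 6,
    and those of terms 1 to 4 to that of term 5. In the second relation, weighted by the square of
    \<open>s\<close>, the first-order terms cancel too, so no negative power of \<open>t\<close>
    survives.\<close>
  let ?L = "[(?b 3 + s *\<^sub>R ?b 2 + s *\<^sub>R s *\<^sub>R ?b 1, ?b 1 + t\<^sup>2 *\<^sub>R ?b 4, ?b 4 - t *\<^sub>R ?b 3 + t\<^sup>2 *\<^sub>R ?b 1),
     (s *\<^sub>R ?b 2 + s *\<^sub>R s *\<^sub>R ?b 1, ?b 1 + t *\<^sub>R ?b 3 + t\<^sup>2 *\<^sub>R ?b 5, ?b 5 + t *\<^sub>R ?b 3),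
     (?b 4 + s *\<^sub>R s *\<^sub>R ?b 1, ?b 2, ?b 4 + t\<^sup>2 *\<^sub>R ?b 2),
     (?b 5 + s *\<^sub>R s *\<^sub>R ?b 1, ?b 2 - t *\<^sub>R ?b 3, ?b 5),
     (- s *\<^sub>R s *\<^sub>R ?b 1, ?b 1 + ?b 2, ?b 4 + ?b 5),
     (- s *\<^sub>R ?b 2, ?b 1, ?b 4 + ?b 5 - t *\<^sub>R ?b 3)]"
  have "?T = (\<Sum>(a, b, c)\<leftarrow>?L. tensor3 a b c)"
    unfolding e_def T_Leit5_def Let_def
    using assms(1)
    by (simp add: vec_eq_iff forall_5 tensor3_def axis_def)
      (simp add: s_def scaleR_conv_of_real of_real_inverse field_simps eval_nat_numeral)
  from tensor_rank_le[OF this] show ?thesis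
    by simp
qed

lemma border_rank_T_Leit5: "border_rank T_Leit5 = 6"
  unfolding border_rank_def
proof (rule Least_equality)
  let ?e = "\<lambda>i j k. tensor3 (basis_vec i) (basis_vec j) (basis_vec k) :: (5, 5, 5) tensor"
  define X where "X t = T_Leit5
    + t *\<^sub>R (?e 1 5 3 - ?e 1 4 3 + ?e 2 1 1 + ?e 2 3 3 + ?e 2 4 4 + ?e 2 5 5 - ?e 3 1 3 - ?e 5 3 5)
    + t\<^sup>2 *\<^sub>R (?e 1 4 1 - ?e 2 4 3 + ?e 2 5 3 + ?e 3 1 1 + ?e 3 4 4 + ?e 4 2 2)
    + t ^ 3 *\<^sub>R (?e 2 4 1 - ?e 3 4 3)
    + t ^ 4 *\<^sub>R ?e 3 4 1" for t
  have "(\<lambda>n. X (inverse (real (Suc n)))) \<longlonglongrightarrow> X 0"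
    unfolding X_def by (intro tendsto_intros LIMSEQ_inverse_real_of_nat)
  then have lim: "(\<lambda>n. X (inverse (real (Suc n)))) \<longlonglongrightarrow> T_Leit5"
    by (simp add: X_def)
  then obtain m where m: "\<And>n. n \<ge> m \<Longrightarrow> 5 < tensor_rank (X (inverse (real (Suc n))))"
    using eventually_tensor_rank_gt_5 unfolding eventually_sequentially by blast
  \<comment> \<open>\<open>border_rank\<close> demands the same rank along the whole sequence, hence
    the shift by \<open>m\<close>.\<close>
  have "tensor_rank (X (inverse (real (Suc (n + m))))) = 6" for n
    using m[of "n + m"] T_Leit5_approximation[of "inverse (real (Suc (n + m)))"]
    unfolding X_def by fastforce
  with LIMSEQ_ignore_initial_segment[OF lim, of m]
  show "\<exists>X. (\<forall>n::nat. tensor_rank (X n) = 6) \<and> X \<longlonglongrightarrow> T_Leit5"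
    by (intro exI[of _ "\<lambda>n. X (inverse (real (Suc (n + m))))"]) blast
next
  fix r assume "\<exists>X. (\<forall>n::nat. tensor_rank (X n) = r) \<and> X \<longlonglongrightarrow> T_Leit5"
  then have "\<forall>\<^sub>F n::nat in sequentially. 5 < r"
    using eventually_tensor_rank_gt_5 by force
  then show "6 \<le> r"
    by simp
qed

theorem proposition5p1:
  fixes \<alpha>1 :: "complex^5"
  defines "\<alpha>1 \<equiv> axis 1 1"
  shows "(\<forall>x. transpose (contract T_Leit5 x) =
           vector [vector [x$1, 0,   0,   0,   0],
                   vector [0,   x$1, 0,   0,   0],
                   vector [x$2, 0,   x$1, 0,   0],
                   vector [x$3, x$4, 0,   x$1, 0],
                   vector [0,   x$5, x$2, 0,   x$1]])
    \<and> rank (contract T_Leit5 \<alpha>1) = 5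
    \<and> abelian_lie_subalgebra (Espace T_Leit5 \<alpha>1)
    \<and> \<not> closed_under_composition (Espace T_Leit5 \<alpha>1)
    \<and> T_Leit5 \<in> Abel_A \<and> T_Leit5 \<notin> End_Abel_A
    \<and> T_Leit5 \<notin> Diag_A
    \<and> border_rank T_Leit5 > 5
    \<and> border_rank T_Leit5 = 6
    \<and> tensor_rank T_Leit5 = 9"
  using contract_T_Leit5_transpose rank_contract_T_Leit5_axis_1 abelian_T_Leit5
    not_closed_T_Leit5[OF rank_contract_T_Leit5_axis_1] T_Leit5_in_Abel_A T_Leit5_notin_End_Abel_A
    T_Leit5_notin_Diag_A border_rank_T_Leit5 tensor_rank_T_Leit5
  unfolding \<alpha>1_def by simp

end
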